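(* Let $SE(2)=\{\vec v\mapsto A\vec v+\vec b:\ A\in SO(2),\ \vec b\in\mathbb{R}^2\}$ act on $\mathbb{R}^2$, with $2$ colors. Then $\mathrm{ext}_D(\mathbb{R}^2,SE(2))<\infty$.
   Context: Let a group $\Gamma$ act faithfully on a set $X$. A coloring $c:X\to\{R,B\}$ is $\Gamma$-distinguishing if the only $\gamma\in\Gamma$ with $c\circ\gamma=c$ is the identity. For $W\subset X$ whose pointwise stabilizer in $\Gamma$ is trivial, the property $P(W)$ holds if every precoloring $c:X\setminus W\to\{R,B\}$ can be extended to a $\Gamma$-distinguishing coloring $X\to\{R,B\}$. The distinguishing extension number $\mathrm{ext}_D(X,\Gamma)$ is the smallest $m$ such that every $W\subset X$ with $|W|\geq m$ and trivial pointwise stabilizer satisfies $P(W)$ ($\infty$ if none exists). *)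

theory Defs
  imports "HOL-Analysis.Analysis" "HOL-Library.Extended_Nat"
begin

text \<open>A group is represented by a set G of maps X \<Rightarrow> X (acting on X by evaluation).
Colorings use two colors, represented by bool (True = R, False = B).\<close>

definition distinguishing :: "'a set \<Rightarrow> ('a \<Rightarrow> 'a) set \<Rightarrow> ('a \<Rightarrow> bool) \<Rightarrow> bool" where
  "distinguishing X G c \<longleftrightarrow>
     (\<forall>g\<in>G. (\<forall>x\<in>X. c (g x) = c x) \<longrightarrow> (\<forall>x\<in>X. g x = x))"

definition trivial_pointwise_stabilizer :: "'a set \<Rightarrow> ('a \<Rightarrow> 'a) set \<Rightarrow> 'a set \<Rightarrow> bool" where
  "trivial_pointwise_stabilizer X G W \<longleftrightarrow>
     (\<forall>g\<in>G. (\<forall>w\<in>W. g w = w) \<longrightarrow> (\<forall>x\<in>X. g x = x))"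

text \<open>Property P(W): every precoloring of X - W extends to a distinguishing coloring of X.
A precoloring is any function whose values are only relevant on X - W.\<close>
definition prop_P :: "'a set \<Rightarrow> ('a \<Rightarrow> 'a) set \<Rightarrow> 'a set \<Rightarrow> bool" where
  "prop_P X G W \<longleftrightarrow>
     (\<forall>c :: 'a \<Rightarrow> bool. \<exists>c'. (\<forall>x\<in>X - W. c' x = c x) \<and> distinguishing X G c')"

definition card_at_least :: "'a set \<Rightarrow> nat \<Rightarrow> bool" where
  "card_at_least W m \<longleftrightarrow> infinite W \<or> m \<le> card W"

definition ext_D_good :: "'a set \<Rightarrow> ('a \<Rightarrow> 'a) set \<Rightarrow> nat \<Rightarrow> bool" where
  "ext_D_good X G m \<longleftrightarrow>
     (\<forall>W. W \<subseteq> X \<and> card_at_least W m \<and> trivial_pointwise_stabilizer X G W \<longrightarrow> prop_P X G W)"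

definition ext_D :: "'a set \<Rightarrow> ('a \<Rightarrow> 'a) set \<Rightarrow> enat" where
  "ext_D X G = (if \<exists>m. ext_D_good X G m then enat (LEAST m. ext_D_good X G m) else \<infinity>)"

definition SE2 :: "(real^2 \<Rightarrow> real^2) set" where
  "SE2 = {(\<lambda>v. A *v v + b) | A b. rotation_matrix (A :: real^2^2)}"

end

theory Submission
  imports Defs "HOL-Computational_Algebra.Polynomial"
begin

text \<open>
  Identify the plane with the complex numbers, so that rigid motions become maps z \<mapsto> a z + b
  with a \<noteq> 0. For the group of all such maps, over any field of characteristic 0, nine points
  suffice.

  Suppose first that some translation by \<tau> \<noteq> 0 preserves the coloring up to finitely many
  points, and let f be the 0/1 function of the coloring. Then D(x) = f(x - \<tau>) - f(x) has finite
  support, and summation by parts assigns a value to the formal moment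
  \<open>\<Sum>x. f x * p x\<close>, namely the sum of D q for any polynomial q with
  q(x + \<tau>) - q(x) = p(x). If the sum of D is 0, this does not depend on the choice of q; it is
  invariant under symmetries of f; and recoloring a point w adds p(w). (If the sum of D is not 0,
  there are no nontrivial symmetries at all.) A symmetry fixes the centroid and multiplies the n-th
  central moment by \<open>a\<^sup>n\<close>, so it is trivial once the second and the third central
  moment are nonzero. If the zeroth moment is not -1, 0 or 1, these are nontrivial polynomial
  conditions, of degrees 2 and 3, on one further recolored point, so one of six candidates meets
  both. At most three points adjust the zeroth moment beforehand.

  Otherwise recolor a point w that is moved by some symmetry of the coloring. The commutator of this
  symmetry with a symmetry of the new coloring is a translation preserving the coloring up to
  finitely many points, hence trivial; but if the two commute, comparing the colors of the images
  of w shows that the second one fixes w and another point, hence is trivial.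
\<close>

section \<open>Differences of polynomials\<close>

definition poly_diff :: "'a \<Rightarrow> 'a poly \<Rightarrow> 'a::comm_ring_1 poly" where
  "poly_diff \<tau> q = pcompose q [:\<tau>, 1:] - q"

lemma poly_poly_diff [simp]: "poly (poly_diff \<tau> q) x = poly q (x + \<tau>) - poly q x"
  by (simp add: poly_diff_def poly_pcompose add.commute)

lemma poly_diff_add: "poly_diff \<tau> (p + q) = poly_diff \<tau> p + poly_diff \<tau> q"
  and poly_diff_diff: "poly_diff \<tau> (p - q) = poly_diff \<tau> p - poly_diff \<tau> q"
  and poly_diff_smult: "poly_diff \<tau> (smult a p) = smult a (poly_diff \<tau> p)"
  by (simp_all add: poly_diff_def pcompose_add pcompose_diff pcompose_smult smult_diff_right)

lemma poly_diff_X: "poly_diff \<tau> [:0, 1:] = smult \<tau> 1"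
  by (simp add: poly_diff_def pcompose_pCons one_pCons)

lemma poly_diff_commute:
  fixes q :: "'a::{idom, ring_char_0} poly"
  shows "poly_diff \<sigma> (poly_diff \<tau> q) = poly_diff \<tau> (poly_diff \<sigma> q)"
  by (intro poly_ext) (simp add: algebra_simps)

lemma poly_diff_pcompose_affine:
  fixes q :: "'a::{idom, ring_char_0} poly"
  shows "poly_diff \<tau> (pcompose q [:b, a:]) = pcompose (poly_diff (a * \<tau>) q) [:b, a:]"
  by (intro poly_ext) (simp add: poly_pcompose algebra_simps)

lemma pcompose_power: "pcompose (p ^ n) q = pcompose p q ^ n"
  for p q :: "'a::comm_semiring_1 poly"
  by (induction n) (simp_all add: pcompose_1 pcompose_mult)

lemma coeff_poly_diff_monom:
  assumes "n \<le> i"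
  shows "coeff (poly_diff \<tau> (monom 1 (Suc n))) i = (if i = n then of_nat (Suc n) * \<tau> else 0)"
proof -
  have "pcompose (monom 1 (Suc n)) [:\<tau>, 1:] = [:\<tau>, 1:] ^ Suc n"
    by (simp add: monom_altdef pcompose_power pcompose_pCons del: power_Suc)
  then have diff: "poly_diff \<tau> (monom 1 (Suc n)) = [:\<tau>, 1:] ^ Suc n - monom 1 (Suc n)"
    by (simp only: poly_diff_def)
  consider "i = n" | "i = Suc n" | "i > Suc n" using assms by linarith
  then show ?thesis
  proof cases
    case 3
    then have "coeff ([:\<tau>, 1:] ^ Suc n) i = 0"
      by (intro coeff_eq_0) (simp only: degree_linear_power)
    then show ?thesis using 3 by (simp add: diff del: power_Suc)
  qed (simp_all add: diff coeff_linear_poly_power del: power_Suc)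
qed

lemma poly_diff_surj:
  fixes \<tau> :: "'a::field_char_0"
  assumes "\<tau> \<noteq> 0"
  obtains q where "poly_diff \<tau> q = p"
proof -
  have "\<exists>q. poly_diff \<tau> q = p" if "\<And>i. i \<ge> n \<Longrightarrow> coeff p i = 0" for n p
    using that
  proof (induction n arbitrary: p)
    case 0
    then have "p = 0" by (simp add: poly_eq_iff)
    then show ?case by (intro exI[of _ 0]) (simp add: poly_diff_def)
  next
    case (Suc n)
    define k where "k = coeff p n / (of_nat (Suc n) * \<tau>)"
    have k: "k * (of_nat (Suc n) * \<tau>) = coeff p n"
      using assms by (simp add: k_def del: of_nat_Suc)
    have "coeff (p - smult k (poly_diff \<tau> (monom 1 (Suc n)))) i = 0" if "i \<ge> n" for i
      using k Suc.prems[of i] that by (auto simp: coeff_poly_diff_monom simp del: of_nat_Suc)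
    then obtain q where "poly_diff \<tau> q = p - smult k (poly_diff \<tau> (monom 1 (Suc n)))"
      using Suc.IH by blast
    then have "poly_diff \<tau> (q + smult k (monom 1 (Suc n))) = p"
      by (simp add: poly_diff_add poly_diff_smult)
    then show ?case by blast
  qed
  from this[of "Suc (degree p)" p] show ?thesis
    using that by (meson coeff_eq_0 less_eq_Suc_le)
qed

lemma poly_diff_eq_0:
  fixes \<tau> :: "'a::field_char_0"
  assumes "\<tau> \<noteq> 0" "poly_diff \<tau> q = 0"
  shows "q = [:poly q 0:]"
proof (rule poly_eqI_degree)
  let ?A = "(\<lambda>n. of_nat n * \<tau>) ` {..degree q}"
  have periodic: "poly q (x + \<tau>) = poly q x" for x
    using arg_cong[OF assms(2), of "\<lambda>p. poly p x"] by simp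
  have "poly q (of_nat n * \<tau>) = poly q 0" for n
  proof (induction n)
    case (Suc n)
    then show ?case using periodic[of "of_nat n * \<tau>"] by (simp add: algebra_simps)
  qed simp
  then show "poly q x = poly [:poly q 0:] x" if "x \<in> ?A" for x
    using that by auto
  have "card ?A = Suc (degree q)"
    using assms(1) by (subst card_image) (auto simp: inj_on_def)
  then show "degree q < card ?A" "degree [:poly q 0:] < card ?A" by simp_all
qed

lemma exists_nonroot:
  fixes p :: "'a::idom poly"
  assumes "p \<noteq> 0" "degree p < card A"
  obtains x where "x \<in> A" "poly p x \<noteq> 0"
  using poly_eqI_degree[of A p 0] assms by auto

section \<open>Symmetries up to finitely many points\<close>

definition almost_symmetry :: "('a \<Rightarrow> 'a) \<Rightarrow> ('a \<Rightarrow> 'b) \<Rightarrow> bool" where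
  "almost_symmetry g f \<longleftrightarrow> finite {x. f (g x) \<noteq> f x}"

lemma almost_symmetry_comp:
  assumes "almost_symmetry g f" "almost_symmetry h f" "inj h"
  shows "almost_symmetry (g \<circ> h) f"
proof -
  have "{x. f ((g \<circ> h) x) \<noteq> f x} \<subseteq> h -` {x. f (g x) \<noteq> f x} \<union> {x. f (h x) \<noteq> f x}" by auto
  then show ?thesis
    using assms unfolding almost_symmetry_def by (meson finite_UnI finite_vimageI finite_subset)
qed

lemma almost_symmetry_cancel_right:
  assumes "almost_symmetry (g \<circ> h) f" "almost_symmetry h f" "surj h"
  shows "almost_symmetry g f"
proof -
  have "{y. f (g y) \<noteq> f y} \<subseteq> h ` ({x. f ((g \<circ> h) x) \<noteq> f x} \<union> {x. f (h x) \<noteq> f x})"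
  proof
    fix y assume y: "y \<in> {y. f (g y) \<noteq> f y}"
    obtain x where "y = h x" using assms(3) by (metis surjD)
    then show "y \<in> h ` ({x. f ((g \<circ> h) x) \<noteq> f x} \<union> {x. f (h x) \<noteq> f x})"
      using y by auto
  qed
  then show ?thesis
    using assms unfolding almost_symmetry_def by (meson finite_UnI finite_imageI finite_subset)
qed

lemma almost_symmetry_cong_finite:
  assumes "almost_symmetry g f" "inj g" "finite {x. f' x \<noteq> f x}"
  shows "almost_symmetry g f'"
proof -
  have "{x. f' (g x) \<noteq> f' x} \<subseteq>
      {x. f (g x) \<noteq> f x} \<union> g -` {x. f' x \<noteq> f x} \<union> {x. f' x \<noteq> f x}" by auto
  then show ?thesis
    using assms unfolding almost_symmetry_def by (meson finite_UnI finite_vimageI finite_subset)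
qed

lemma commuting_symmetries_recoloring:
  assumes "\<And>x. c (g x) = c x" "\<And>x. (c(w := \<not> c w)) (h x) = (c(w := \<not> c w)) x"
    and "\<And>x. g (h x) = h (g x)"
  shows "g w = w \<or> h w = w"
proof (rule ccontr)
  assume "\<not> ?thesis"
  then have "c (h w) \<noteq> c w" "(c(w := \<not> c w)) (h (g w)) = c w"
    using assms(1)[of w] assms(2)[of w] assms(2)[of "g w"] by simp_all
  moreover have "c (h (g w)) = c (h w)" using assms(1)[of "h w"] assms(3)[of w] by simp
  ultimately show False by (simp split: if_splits)
qed

section \<open>The affine group of a field\<close>

definition affine_group :: "('a::field \<Rightarrow> 'a) set" where
  "affine_group = {\<lambda>x. a * x + b | a b. a \<noteq> 0}"

definition affine_symmetry :: "'a::field \<Rightarrow> 'a \<Rightarrow> ('a \<Rightarrow> 'b) \<Rightarrow> bool" where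
  "affine_symmetry a b f \<longleftrightarrow> a \<noteq> 0 \<and> (\<forall>x. f (a * x + b) = f x)"

definition affinely_rigid :: "('a::field \<Rightarrow> 'b) \<Rightarrow> bool" where
  "affinely_rigid f \<longleftrightarrow> (\<forall>a b. affine_symmetry a b f \<longrightarrow> a = 1 \<and> b = 0)"

lemma bij_affine:
  fixes a :: "'a::field"
  assumes "a \<noteq> 0"
  shows "bij (\<lambda>x. a * x + b)"
  by (rule bij_betw_byWitness[where f' = "\<lambda>y. (y - b) / a"]) (use assms in auto)

lemma affine_two_fixed_points:
  fixes a :: "'a::field"
  assumes "a * x + b = x" "a * y + b = y" "x \<noteq> y"
  shows "a = 1 \<and> b = 0"
proof -
  have "(a - 1) * (x - y) = (a * x + b - x) - (a * y + b - y)" by (simp add: algebra_simps)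
  then have "(a - 1) * (x - y) = 0" using assms(1,2) by simp
  then show ?thesis using assms by simp
qed

lemma distinguishing_if_affinely_rigid:
  assumes "affinely_rigid c"
  shows "distinguishing UNIV affine_group c"
  unfolding distinguishing_def
proof (intro ballI impI)
  fix g x assume "g \<in> affine_group" and "\<forall>x\<in>UNIV. c (g x) = c x"
  then obtain a b where g: "g = (\<lambda>x. a * x + b)" and "affine_symmetry a b c"
    by (auto simp: affine_group_def affine_symmetry_def)
  then have "a = 1 \<and> b = 0" using assms by (simp add: affinely_rigid_def)
  then show "g x = x" by (simp add: g)
qed

lemma affine_almost_symmetries_commute:
  fixes a b a' b' :: "'a::field"
  defines "g \<equiv> \<lambda>x. a * x + b" and "h \<equiv> \<lambda>x. a' * x + b'"
  assumes aperiodic: "\<And>\<tau>. almost_symmetry (\<lambda>x. x - \<tau>) f \<Longrightarrow> \<tau> = 0"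
    and "a \<noteq> 0" "a' \<noteq> 0" and sym: "almost_symmetry g f" "almost_symmetry h f"
  shows "g (h x) = h (g x)"
proof -
  have bij: "bij g" "bij h"
    unfolding g_def h_def by (rule bij_affine, fact)+
  define \<tau> where "\<tau> = (a' * b + b') - (a * b' + b)"
  have commutator: "(\<lambda>x. x - \<tau>) \<circ> (h \<circ> g) = g \<circ> h"
    by (simp add: fun_eq_iff g_def h_def \<tau>_def algebra_simps)
  have "almost_symmetry (g \<circ> h) f" "almost_symmetry (h \<circ> g) f"
    using sym bij by (blast intro: almost_symmetry_comp dest: bij_is_inj)+
  then have "almost_symmetry (\<lambda>x. x - \<tau>) f"
    using almost_symmetry_cancel_right[of "\<lambda>x. x - \<tau>" "h \<circ> g"]
      bij_is_surj[OF bij_comp[OF bij]] unfolding commutator by blast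
  then have "\<tau> = 0" by (rule aperiodic)
  then show ?thesis using fun_cong[OF commutator, of x] by simp
qed

lemma affinely_rigid_recoloring:
  fixes c :: "'a::field \<Rightarrow> bool"
  assumes aperiodic: "\<And>\<tau>. almost_symmetry (\<lambda>x. x - \<tau>) c \<Longrightarrow> \<tau> = 0"
    and sym: "affine_symmetry a b c" and moved: "a * w + b \<noteq> w"
  shows "affinely_rigid (c(w := \<not> c w))"
  unfolding affinely_rigid_def
proof (intro allI impI)
  let ?c = "c(w := \<not> c w)"
  fix a' b' assume sym': "affine_symmetry a' b' ?c"
  let ?g = "\<lambda>x. a * x + b" and ?h = "\<lambda>x. a' * x + b'"
  have nonzero: "a \<noteq> 0" "a' \<noteq> 0" and invariant: "c (?g x) = c x" "?c (?h x) = ?c x" for x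
    using sym sym' unfolding affine_symmetry_def by blast+
  then have "almost_symmetry ?g c" "almost_symmetry ?h ?c"
    by (simp_all add: almost_symmetry_def)
  moreover have "finite {x. c x \<noteq> ?c x}" by (rule finite_subset[of _ "{w}"]) auto
  ultimately have "almost_symmetry ?h c"
    using almost_symmetry_cong_finite bij_is_inj[OF bij_affine[OF nonzero(2)]] by blast
  then have commute: "?g (?h x) = ?h (?g x)" for x
    using affine_almost_symmetries_commute[OF aperiodic nonzero] \<open>almost_symmetry ?g c\<close> by blast
  then have "?g w = w \<or> ?h w = w"
    using commuting_symmetries_recoloring[of c ?g w ?h] invariant by blast
  then have "?h w = w" using moved by simp
  moreover from this have "?h (?g w) = ?g w" using commute[of w] by simp
  ultimately show "a' = 1 \<and> b' = 0"
    using affine_two_fixed_points[of a' "?g w" b' w] moved by blast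
qed

section \<open>Pairing finitely supported functions with polynomials\<close>

definition finite_support :: "('a \<Rightarrow> 'b::zero) \<Rightarrow> bool" where
  "finite_support h \<longleftrightarrow> finite {x. h x \<noteq> 0}"

definition pairing :: "('a \<Rightarrow> 'a) \<Rightarrow> 'a poly \<Rightarrow> 'a::comm_ring_1" where
  "pairing h q = (\<Sum>x | h x \<noteq> 0. h x * poly q x)"

definition back_diff :: "'a \<Rightarrow> ('a \<Rightarrow> 'b) \<Rightarrow> 'a::ab_group_add \<Rightarrow> 'b::ab_group_add" where
  "back_diff \<tau> f x = f (x - \<tau>) - f x"

definition add_points :: "('a \<Rightarrow> 'b::semiring_1) \<Rightarrow> 'a set \<Rightarrow> 'a \<Rightarrow> 'b" where
  "add_points f S x = f x + of_bool (x \<in> S)"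

lemma finite_support_back_diff:
  "finite_support (back_diff \<tau> f) \<longleftrightarrow> almost_symmetry (\<lambda>x. x - \<tau>) f"
  by (simp add: finite_support_def back_diff_def almost_symmetry_def)

lemma pairing_superset:
  assumes "finite B" "\<And>x. h x \<noteq> 0 \<Longrightarrow> x \<in> B"
  shows "pairing h q = (\<Sum>x\<in>B. h x * poly q x)"
  unfolding pairing_def using assms by (intro sum.mono_neutral_left) auto

lemma pairing_add_right: "pairing h (p + q) = pairing h p + pairing h q"
  and pairing_diff_right: "pairing h (p - q) = pairing h p - pairing h q"
  and pairing_smult_right: "pairing h (smult a q) = a * pairing h q"
  by (simp_all add: pairing_def algebra_simps sum.distrib sum_subtractf sum_distrib_left)

lemma pairing_of_bool_mem:
  assumes "finite S"
  shows "pairing (\<lambda>x. of_bool (x \<in> S)) q = (\<Sum>x\<in>S. poly q x)"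
  by (subst pairing_superset[OF assms]) (auto intro!: sum.cong)

lemma
  assumes "finite_support h" "finite_support k"
  shows pairing_add_left: "pairing (\<lambda>x. h x + k x) q = pairing h q + pairing k q"
    and pairing_diff_left: "pairing (\<lambda>x. h x - k x) q = pairing h q - pairing k q"
proof -
  let ?B = "{x. h x \<noteq> 0} \<union> {x. k x \<noteq> 0}"
  have finite: "finite ?B" using assms by (simp add: finite_support_def)
  show "pairing (\<lambda>x. h x + k x) q = pairing h q + pairing k q"
    "pairing (\<lambda>x. h x - k x) q = pairing h q - pairing k q"
    by (subst (1 2 3) pairing_superset[OF finite];
        auto simp: algebra_simps sum.distrib sum_subtractf)+
qed

lemma
  fixes h :: "'a::field \<Rightarrow> 'a"
  assumes "a \<noteq> 0"
  shows finite_support_affine: "finite_support (\<lambda>x. h (a * x + b)) \<longleftrightarrow> finite_support h"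
    and pairing_affine: "pairing (\<lambda>x. h (a * x + b)) (pcompose q [:b, a:]) = pairing h q"
proof -
  let ?g = "\<lambda>x. a * x + b"
  have "bij_betw ?g {x. h (?g x) \<noteq> 0} {y. h y \<noteq> 0}"
    by (rule bij_betw_byWitness[of _ "\<lambda>y. (y - b) / a"]) (use assms in auto)
  then show "finite_support (\<lambda>x. h (a * x + b)) \<longleftrightarrow> finite_support h"
    unfolding finite_support_def by (rule bij_betw_finite)
  show "pairing (\<lambda>x. h (a * x + b)) (pcompose q [:b, a:]) = pairing h q"
    unfolding pairing_def
    by (rule sum.reindex_bij_witness[of _ "\<lambda>y. (y - b) / a" ?g])
      (use assms in \<open>auto simp: poly_pcompose mult.commute add.commute\<close>)
qed

lemma finite_support_shift:
  fixes h :: "'a::field \<Rightarrow> 'a"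
  shows "finite_support (\<lambda>x. h (x - \<sigma>)) \<longleftrightarrow> finite_support h"
  using finite_support_affine[of 1 h "- \<sigma>"] by simp

lemma pairing_shift:
  fixes \<sigma> :: "'a::field"
  shows "pairing (\<lambda>x. h (x - \<sigma>)) q = pairing h (pcompose q [:\<sigma>, 1:])"
proof -
  have "pcompose (pcompose q [:\<sigma>, 1:]) [:- \<sigma>, 1:] = q"
    by (simp add: pcompose_assoc [symmetric] pcompose_pCons)
  then show ?thesis using pairing_affine[of 1 h "- \<sigma>" "pcompose q [:\<sigma>, 1:]"] by simp
qed

lemma pairing_back_diff:
  fixes \<sigma> :: "'a::field"
  assumes "finite_support h"
  shows "pairing (back_diff \<sigma> h) q = pairing h (poly_diff \<sigma> q)"
  using pairing_diff_left[of "\<lambda>x. h (x - \<sigma>)" h q] assms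
  by (simp add: back_diff_def[abs_def] finite_support_shift pairing_shift poly_diff_def
      pairing_diff_right)

lemma pairing_back_diff_commute:
  fixes \<sigma> :: "'a::field"
  assumes "finite_support (back_diff \<sigma> f)" "finite_support (back_diff \<tau> f)"
  shows "pairing (back_diff \<tau> f) (poly_diff \<sigma> r) = pairing (back_diff \<sigma> f) (poly_diff \<tau> r)"
proof -
  have "back_diff \<sigma> (back_diff \<tau> f) = back_diff \<tau> (back_diff \<sigma> f)"
    by (simp add: back_diff_def fun_eq_iff algebra_simps)
  then show ?thesis using assms by (metis pairing_back_diff)
qed

lemma
  assumes "affine_symmetry a b f"
  shows finite_support_back_diff_symmetry:
      "finite_support (back_diff (a * \<tau>) f) \<longleftrightarrow> finite_support (back_diff \<tau> f)"
    and pairing_back_diff_symmetry: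
      "pairing (back_diff \<tau> f) (pcompose q [:b, a:]) = pairing (back_diff (a * \<tau>) f) q"
proof -
  have "a \<noteq> 0" and invariant: "f (a * x + b) = f x" for x
    using assms by (auto simp: affine_symmetry_def)
  have "f (a * x + b - a * \<tau>) = f (x - \<tau>)" for x
    using invariant[of "x - \<tau>"] by (simp add: algebra_simps)
  then have "(\<lambda>x. back_diff (a * \<tau>) f (a * x + b)) = back_diff \<tau> f"
    by (simp add: back_diff_def fun_eq_iff invariant)
  then show "finite_support (back_diff (a * \<tau>) f) \<longleftrightarrow> finite_support (back_diff \<tau> f)"
    "pairing (back_diff \<tau> f) (pcompose q [:b, a:]) = pairing (back_diff (a * \<tau>) f) q"
    using finite_support_affine[OF \<open>a \<noteq> 0\<close>, of "back_diff (a * \<tau>) f" b]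
      pairing_affine[OF \<open>a \<noteq> 0\<close>, of "back_diff (a * \<tau>) f" b q] by simp_all
qed

lemma
  fixes f :: "'a::field \<Rightarrow> 'a"
  assumes "finite S" "finite_support (back_diff \<tau> f)"
  shows finite_support_back_diff_add_points: "finite_support (back_diff \<tau> (add_points f S))"
    and pairing_back_diff_add_points: "pairing (back_diff \<tau> (add_points f S)) q
      = pairing (back_diff \<tau> f) q + (\<Sum>x\<in>S. poly (poly_diff \<tau> q) x)"
proof -
  let ?i = "\<lambda>x. of_bool (x \<in> S) :: 'a"
  have "finite {x. add_points f S x \<noteq> f x}"
    using assms(1) by (simp add: add_points_def)
  then show "finite_support (back_diff \<tau> (add_points f S))"
    using assms(2) almost_symmetry_cong_finite
    by (fastforce simp: finite_support_back_diff)
  have supp: "finite_support ?i" using assms(1) by (simp add: finite_support_def)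
  have "finite_support (back_diff \<tau> ?i)"
    unfolding finite_support_back_diff
    by (rule almost_symmetry_cong_finite[of _ "\<lambda>_. 0"])
      (use assms(1) in \<open>simp_all add: almost_symmetry_def\<close>)
  moreover have "back_diff \<tau> (add_points f S) = (\<lambda>x. back_diff \<tau> f x + back_diff \<tau> ?i x)"
    by (simp add: back_diff_def add_points_def fun_eq_iff)
  ultimately show "pairing (back_diff \<tau> (add_points f S)) q
      = pairing (back_diff \<tau> f) q + (\<Sum>x\<in>S. poly (poly_diff \<tau> q) x)"
    using assms by (simp add: pairing_add_left pairing_back_diff[OF supp] pairing_of_bool_mem)
qed

section \<open>Moments of almost periodic functions\<close>

definition flux :: "'a \<Rightarrow> ('a \<Rightarrow> 'a) \<Rightarrow> 'a::field" where
  "flux \<tau> f = pairing (back_diff \<tau> f) 1"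

lemma affinely_rigid_if_flux:
  fixes f :: "'a::field \<Rightarrow> 'a"
  assumes "\<tau> \<noteq> 0" "finite_support (back_diff \<tau> f)" "flux \<tau> f \<noteq> 0"
  shows "affinely_rigid f"
  unfolding affinely_rigid_def
proof (intro allI impI)
  fix a b assume sym: "affine_symmetry a b f"
  let ?D = "back_diff \<tau> f"
  have "finite_support (back_diff (a * \<tau>) f)"
    using assms(2) finite_support_back_diff_symmetry[OF sym] by blast
  from pairing_back_diff_commute[OF this assms(2), of "[:0, 1:]"]
  have "a * \<tau> * flux \<tau> f = \<tau> * flux (a * \<tau>) f"
    by (simp only: poly_diff_X pairing_smult_right flux_def)
  moreover have "flux \<tau> f = flux (a * \<tau>) f"
    using pairing_back_diff_symmetry[OF sym, of \<tau> 1] by (simp add: pcompose_1 flux_def)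
  ultimately have a: "a = 1" using assms(1,3) by simp
  have "pcompose [:0, 1:] [:b, 1:] = [:0, 1:] + smult b 1"
    by (simp add: pcompose_pCons one_pCons)
  then have "pairing ?D [:0, 1:] + b * flux \<tau> f = pairing ?D [:0, 1:]"
    using pairing_back_diff_symmetry[OF sym, of \<tau> "[:0, 1:]"]
    by (simp only: a mult_1_left pairing_add_right pairing_smult_right flux_def)
  then show "a = 1 \<and> b = 0" using a assms(3) by simp
qed

text \<open>The formal value of \<open>\<Sum>x. f x * poly p x\<close>; the choice of q is immaterial only
  when the flux is 0.\<close>
definition moment :: "'a \<Rightarrow> ('a \<Rightarrow> 'a) \<Rightarrow> 'a poly \<Rightarrow> 'a::field" where
  "moment \<tau> f p = pairing (back_diff \<tau> f) (SOME q. poly_diff \<tau> q = p)"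

definition centroid :: "'a \<Rightarrow> ('a \<Rightarrow> 'a) \<Rightarrow> 'a::field" where
  "centroid \<tau> f = moment \<tau> f [:0, 1:] / moment \<tau> f 1"

definition central_moment :: "'a \<Rightarrow> ('a \<Rightarrow> 'a) \<Rightarrow> nat \<Rightarrow> 'a::field" where
  "central_moment \<tau> f n = moment \<tau> f ([:- centroid \<tau> f, 1:] ^ n)"

locale fluxless_almost_period =
  fixes \<tau> :: "'a::field_char_0" and f :: "'a \<Rightarrow> 'a"
  assumes nonzero: "\<tau> \<noteq> 0"
    and finite_support: "finite_support (back_diff \<tau> f)"
    and flux_zero: "flux \<tau> f = 0"
begin

lemma moment_eq:
  assumes "poly_diff \<tau> q = p"
  shows "moment \<tau> f p = pairing (back_diff \<tau> f) q"
proof -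
  define q' where "q' = (SOME q. poly_diff \<tau> q = p)"
  have "poly_diff \<tau> q' = p" unfolding q'_def using assms by (rule someI)
  then have "poly_diff \<tau> (q' - q) = 0" using assms by (simp add: poly_diff_diff)
  then obtain k where "q' - q = [:k:]" using poly_diff_eq_0[OF nonzero] by blast
  then have "q' = q + smult k 1" by (simp add: one_pCons algebra_simps)
  then have "pairing (back_diff \<tau> f) q' = pairing (back_diff \<tau> f) q + k * flux \<tau> f"
    by (simp only: pairing_add_right pairing_smult_right flux_def)
  then show ?thesis using flux_zero by (simp add: moment_def q'_def)
qed

lemma moment_add: "moment \<tau> f (p + q) = moment \<tau> f p + moment \<tau> f q"
proof -
  obtain P where P: "poly_diff \<tau> P = p" using poly_diff_surj[OF nonzero] .
  obtain Q where Q: "poly_diff \<tau> Q = q" using poly_diff_surj[OF nonzero] .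
  have "poly_diff \<tau> (P + Q) = p + q" using P Q by (simp add: poly_diff_add)
  then show ?thesis
    by (simp add: moment_eq[OF P] moment_eq[OF Q] moment_eq pairing_add_right)
qed

lemma moment_smult: "moment \<tau> f (smult k p) = k * moment \<tau> f p"
proof -
  obtain P where P: "poly_diff \<tau> P = p" using poly_diff_surj[OF nonzero] .
  have "poly_diff \<tau> (smult k P) = smult k p" using P by (simp add: poly_diff_smult)
  then show ?thesis by (simp add: moment_eq[OF P] moment_eq pairing_smult_right)
qed

lemma moment_symmetry:
  assumes sym: "affine_symmetry a b f"
  shows "moment \<tau> f (pcompose p [:b, a:]) = moment \<tau> f p"
proof -
  let ?\<tau> = "a * \<tau>"
  have finite_support': "finite_support (back_diff ?\<tau> f)"
    using finite_support finite_support_back_diff_symmetry[OF sym] by blast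
  \<comment> \<open>A common second antidifference r of p links the moments computed with \<tau> and with a \<tau>.\<close>
  obtain q where q: "poly_diff \<tau> q = p" using poly_diff_surj[OF nonzero] .
  have "?\<tau> \<noteq> 0" using nonzero sym by (simp add: affine_symmetry_def)
  then obtain r where r: "poly_diff ?\<tau> r = q" using poly_diff_surj by blast
  have "poly_diff \<tau> (pcompose (poly_diff \<tau> r) [:b, a:]) = pcompose p [:b, a:]"
    using q r by (simp add: poly_diff_pcompose_affine poly_diff_commute[of ?\<tau> \<tau>])
  then have "moment \<tau> f (pcompose p [:b, a:])
      = pairing (back_diff \<tau> f) (pcompose (poly_diff \<tau> r) [:b, a:])"
    by (rule moment_eq)
  also have "\<dots> = pairing (back_diff ?\<tau> f) (poly_diff \<tau> r)"
    by (rule pairing_back_diff_symmetry[OF sym])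
  also have "\<dots> = pairing (back_diff \<tau> f) (poly_diff ?\<tau> r)"
    by (rule pairing_back_diff_commute[OF finite_support finite_support'])
  also have "\<dots> = moment \<tau> f p"
    unfolding r using moment_eq[OF q] by simp
  finally show ?thesis .
qed

lemma fluxless_add_points:
  assumes "finite S"
  shows "fluxless_almost_period \<tau> (add_points f S)"
proof
  show "finite_support (back_diff \<tau> (add_points f S))"
    using finite_support_back_diff_add_points[OF assms finite_support] .
  show "flux \<tau> (add_points f S) = 0"
    using flux_zero by (simp add: flux_def pairing_back_diff_add_points[OF assms finite_support])
qed (rule nonzero)

lemma moment_add_points:
  assumes "finite S"
  shows "moment \<tau> (add_points f S) p = moment \<tau> f p + (\<Sum>x\<in>S. poly p x)"
proof -
  interpret added: fluxless_almost_period \<tau> "add_points f S"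
    using assms by (rule fluxless_add_points)
  obtain q where q: "poly_diff \<tau> q = p" using poly_diff_surj[OF nonzero] .
  show ?thesis
    unfolding moment_eq[OF q] added.moment_eq[OF q]
      pairing_back_diff_add_points[OF assms finite_support] q ..
qed

lemma centroid_fixed:
  assumes "affine_symmetry a b f" "moment \<tau> f 1 \<noteq> 0"
  shows "a * centroid \<tau> f + b = centroid \<tau> f"
proof -
  have "pcompose [:0, 1:] [:b, a:] = smult a [:0, 1:] + smult b 1"
    by (simp add: pcompose_pCons one_pCons)
  then have "a * moment \<tau> f [:0, 1:] + b * moment \<tau> f 1 = moment \<tau> f [:0, 1:]"
    using moment_symmetry[OF assms(1), of "[:0, 1:]"] by (simp only: moment_add moment_smult)
  then show ?thesis using assms(2) by (simp add: centroid_def field_simps)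
qed

lemma central_moment_symmetry:
  assumes "affine_symmetry a b f" "moment \<tau> f 1 \<noteq> 0"
  shows "a ^ n * central_moment \<tau> f n = central_moment \<tau> f n"
proof -
  let ?p = "[:- centroid \<tau> f, 1:]"
  have "pcompose ?p [:b, a:] = smult a ?p"
    using centroid_fixed[OF assms] by (simp add: pcompose_pCons algebra_simps)
  then have "pcompose (?p ^ n) [:b, a:] = smult (a ^ n) (?p ^ n)"
    by (simp only: pcompose_power smult_power)
  then show ?thesis
    using moment_symmetry[OF assms(1), of "?p ^ n"] by (simp only: central_moment_def moment_smult)
qed

lemma affinely_rigid_if_central_moments:
  assumes "moment \<tau> f 1 \<noteq> 0" "central_moment \<tau> f 2 \<noteq> 0" "central_moment \<tau> f 3 \<noteq> 0"
  shows "affinely_rigid f"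
  unfolding affinely_rigid_def
proof (intro allI impI)
  fix a b assume sym: "affine_symmetry a b f"
  have "a ^ 2 = 1" "a ^ 3 = 1"
    using central_moment_symmetry[OF sym assms(1), of 2] assms(2)
      central_moment_symmetry[OF sym assms(1), of 3] assms(3) by simp_all
  then have "a = 1" by (simp add: power2_eq_square power3_eq_cube)
  then show "a = 1 \<and> b = 0" using centroid_fixed[OF sym assms(1)] by simp
qed

lemma moment_minus_centroid:
  assumes "moment \<tau> f 1 \<noteq> 0"
  shows "moment \<tau> f [:- centroid \<tau> f, 1:] = 0"
proof -
  have "[:- centroid \<tau> f, 1:] = [:0, 1:] + smult (- centroid \<tau> f) 1" by (simp add: one_pCons)
  then show ?thesis using assms by (simp only: moment_add moment_smult) (simp add: centroid_def)
qed

lemma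
  fixes t
  defines "e \<equiv> centroid \<tau> f"
  assumes "moment \<tau> f 1 \<noteq> 0"
  shows moment_2_off_centroid:
      "moment \<tau> f ([:- (e + t), 1:]\<^sup>2) = central_moment \<tau> f 2 + t\<^sup>2 * moment \<tau> f 1"
    and moment_3_off_centroid: "moment \<tau> f ([:- (e + t), 1:] ^ 3)
      = central_moment \<tau> f 3 - 3 * t * central_moment \<tau> f 2 - t ^ 3 * moment \<tau> f 1"
proof -
  define p where "p = [:- e, 1:]"
  have p: "moment \<tau> f p = 0" "moment \<tau> f (p ^ n) = central_moment \<tau> f n" for n
    using moment_minus_centroid assms by (simp_all add: p_def e_def central_moment_def)
  have shift: "[:- (e + t), 1:] = p - smult t 1" by (simp add: p_def one_pCons)
  have "(p - smult t 1)\<^sup>2 = p\<^sup>2 + smult (- 2 * t) p + smult (t\<^sup>2) 1"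
    by (intro poly_ext) (simp add: poly_power, algebra)
  then show "moment \<tau> f ([:- (e + t), 1:]\<^sup>2) = central_moment \<tau> f 2 + t\<^sup>2 * moment \<tau> f 1"
    unfolding shift by (simp only: moment_add moment_smult p) simp
  have "(p - smult t 1) ^ 3
      = p ^ 3 + smult (- 3 * t) (p\<^sup>2) + smult (3 * t\<^sup>2) p + smult (- (t ^ 3)) 1"
    by (intro poly_ext) (simp add: poly_power, algebra)
  then show "moment \<tau> f ([:- (e + t), 1:] ^ 3)
      = central_moment \<tau> f 3 - 3 * t * central_moment \<tau> f 2 - t ^ 3 * moment \<tau> f 1"
    unfolding shift by (simp only: moment_add moment_smult p) simp
qed

lemma centroid_add_point:
  fixes w
  defines "m \<equiv> moment \<tau> f 1"
  assumes "m \<noteq> 0" "m + 1 \<noteq> 0"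
  shows "centroid \<tau> (add_points f {w}) = centroid \<tau> f + (w - centroid \<tau> f) / (m + 1)"
proof -
  have "moment \<tau> f [:0, 1:] = m * centroid \<tau> f"
    using assms by (simp add: centroid_def)
  then have "centroid \<tau> (add_points f {w}) = (m * centroid \<tau> f + w) / (m + 1)"
    by (simp add: centroid_def[of \<tau> "add_points f {w}"] moment_add_points m_def)
  also have "\<dots> = centroid \<tau> f + (w - centroid \<tau> f) / (m + 1)"
    using assms(3) by (simp add: field_simps)
  finally show ?thesis .
qed

lemma central_moment_add_point:
  fixes w
  defines "m \<equiv> moment \<tau> f 1"
  defines "t \<equiv> (w - centroid \<tau> f) / (m + 1)"
  assumes m: "m \<noteq> 0" "m + 1 \<noteq> 0"
  shows "central_moment \<tau> (add_points f {w}) n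
    = moment \<tau> f ([:- (centroid \<tau> f + t), 1:] ^ n) + (t * m) ^ n"
proof -
  have centroid: "centroid \<tau> (add_points f {w}) = centroid \<tau> f + t"
    using centroid_add_point[of w] m by (simp add: t_def m_def)
  have "poly [:- (centroid \<tau> f + t), 1:] w = t * m"
    using m by (simp add: t_def field_simps)
  then show ?thesis
    by (simp add: central_moment_def[of \<tau> "add_points f {w}"] centroid moment_add_points
        poly_power del: poly_pCons)
qed

lemma
  fixes w
  defines "m \<equiv> moment \<tau> f 1" and "d \<equiv> w - centroid \<tau> f"
  assumes m: "m \<noteq> 0" "m + 1 \<noteq> 0"
  shows central_moment_2_add_point:
      "central_moment \<tau> (add_points f {w}) 2 = central_moment \<tau> f 2 + m / (m + 1) * d\<^sup>2" (is ?two)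
    and central_moment_3_add_point:
      "central_moment \<tau> (add_points f {w}) 3 = central_moment \<tau> f 3
        - 3 * central_moment \<tau> f 2 / (m + 1) * d + m * (m - 1) / (m + 1)\<^sup>2 * d ^ 3" (is ?three)
proof -
  define t where "t = d / (m + 1)"
  have d: "d = t * (m + 1)" using m by (simp add: t_def)
  note expand = central_moment_add_point[of w, folded m_def, folded d_def, folded t_def, OF m]
    moment_2_off_centroid[folded m_def, OF m(1)] moment_3_off_centroid[folded m_def, OF m(1)]
  have "t\<^sup>2 * m + (t * m)\<^sup>2 = m / (m + 1) * d\<^sup>2"
    using m unfolding d by (simp add: power_mult_distrib power2_eq_square) algebra
  then show ?two unfolding expand by (simp add: add.assoc)
  have "(t * m) ^ 3 - t ^ 3 * m = m * (m - 1) / (m + 1)\<^sup>2 * d ^ 3"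
    using m unfolding d by (simp add: power_mult_distrib power2_eq_square power3_eq_cube) algebra
  then show ?three unfolding expand by (simp add: t_def algebra_simps)
qed

lemma exists_affinely_rigid_add_point:
  assumes "moment \<tau> f 1 \<notin> {-1, 0, 1}" "card W \<ge> 6"
  obtains w where "w \<in> W" "affinely_rigid (add_points f {w})"
proof -
  define m where "m = moment \<tau> f 1"
  have m: "m \<noteq> 0" "m - 1 \<noteq> 0" "m + 1 \<noteq> 0"
    using assms(1) by (auto simp: m_def eq_neg_iff_add_eq_0)
  define p where "p = [:central_moment \<tau> f 2, 0, m / (m + 1):]"
  define q where
    "q = [:central_moment \<tau> f 3, - 3 * central_moment \<tau> f 2 / (m + 1), 0, m * (m - 1) / (m + 1)\<^sup>2:]"
  define r where "r = pcompose (p * q) [:- centroid \<tau> f, 1:]"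
  have "degree p = 2" "degree q = 3" "p \<noteq> 0" "q \<noteq> 0" using m by (simp_all add: p_def q_def)
  then have "degree r = 5" by (simp add: r_def degree_pcompose degree_mult_eq)
  then have "r \<noteq> 0" "degree r < card W" using assms(2) by auto
  then obtain w where w: "w \<in> W" "poly r w \<noteq> 0" by (rule exists_nonroot)
  interpret added: fluxless_almost_period \<tau> "add_points f {w}"
    by (rule fluxless_add_points) simp
  have "poly p (w - centroid \<tau> f) \<noteq> 0" "poly q (w - centroid \<tau> f) \<noteq> 0"
    using w(2) by (simp_all add: r_def poly_pcompose)
  moreover have "poly p (w - centroid \<tau> f) = central_moment \<tau> (add_points f {w}) 2"
    using m by (simp add: p_def central_moment_2_add_point m_def power2_eq_square)
  moreover have "poly q (w - centroid \<tau> f) = central_moment \<tau> (add_points f {w}) 3"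
    using m by (simp add: q_def central_moment_3_add_point m_def field_simps power2_eq_square
        power3_eq_cube)
  moreover have "moment \<tau> (add_points f {w}) 1 \<noteq> 0"
    using m by (simp add: moment_add_points m_def)
  ultimately have "affinely_rigid (add_points f {w})"
    using added.affinely_rigid_if_central_moments by simp
  then show ?thesis using that w(1) by blast
qed

lemma exists_add_points_moment_one:
  assumes "card W \<ge> 3"
  obtains S where "S \<subseteq> W" "finite S" "card S \<le> 3" "moment \<tau> (add_points f S) 1 \<notin> {-1, 0, 1}"
proof (cases "moment \<tau> f 1 \<in> {-1, 0, 1}")
  case True
  obtain S where S: "S \<subseteq> W" "card S = 3" "finite S"
    using assms obtain_subset_with_card_n[of 3 W] by auto
  have "moment \<tau> f 1 + 3 \<notin> {-1, 0, 1}"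
    using True by (elim insertE emptyE) (simp_all only:, simp_all)
  then show ?thesis using that S by (simp add: moment_add_points)
next
  case False
  then show ?thesis using that[of "{}"] by (simp add: moment_add_points)
qed

end

section \<open>Rigid extensions of colorings\<close>

lemma exists_affinely_rigid_add_points:
  fixes f :: "'a::field_char_0 \<Rightarrow> 'a"
  assumes "\<tau> \<noteq> 0" "finite_support (back_diff \<tau> f)" "card W \<ge> 9"
  obtains S where "S \<subseteq> W" "affinely_rigid (add_points f S)"
proof (cases "flux \<tau> f = 0")
  case False
  have "add_points f {} = f" by (simp add: add_points_def fun_eq_iff)
  then show ?thesis
    using that[of "{}"] affinely_rigid_if_flux[OF assms(1,2) False] by simp
next
  case True
  then interpret fluxless_almost_period \<tau> f using assms by unfold_locales
  obtain S where S: "S \<subseteq> W" "finite S" "card S \<le> 3"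
    and mass: "moment \<tau> (add_points f S) 1 \<notin> {-1, 0, 1}"
    using exists_add_points_moment_one[of W] assms(3) by auto
  interpret added: fluxless_almost_period \<tau> "add_points f S"
    using S(2) by (rule fluxless_add_points)
  have "card (W - S) \<ge> 6" using S assms(3) by (simp add: card_Diff_subset)
  then obtain w where w: "w \<in> W - S" "affinely_rigid (add_points (add_points f S) {w})"
    using added.exists_affinely_rigid_add_point[OF mass] by blast
  have "add_points (add_points f S) {w} = add_points f (insert w S)"
    using w(1) by (auto simp: add_points_def fun_eq_iff)
  then show ?thesis using that[of "insert w S"] w S(1) by auto
qed

lemma rigid_extension_if_almost_period:
  fixes c :: "'a::field_char_0 \<Rightarrow> bool"
  assumes "\<tau> \<noteq> 0" "almost_symmetry (\<lambda>x. x - \<tau>) c" "card W \<ge> 9"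
  obtains c' where "\<And>x. x \<notin> W \<Longrightarrow> c' x = c x" "affinely_rigid c'"
proof -
  define c\<^sub>0 where "c\<^sub>0 x \<longleftrightarrow> c x \<and> x \<notin> W" for x
  define f where "f x = (of_bool (c\<^sub>0 x) :: 'a)" for x
  have "finite W" using assms(3) by (intro card_ge_0_finite) simp
  then have "finite {x. c\<^sub>0 x \<noteq> c x}" by (rule finite_subset[rotated]) (auto simp: c\<^sub>0_def)
  then have "almost_symmetry (\<lambda>x. x - \<tau>) c\<^sub>0"
    by (rule almost_symmetry_cong_finite[OF assms(2), rotated]) simp
  then have "finite_support (back_diff \<tau> f)"
    by (simp only: finite_support_back_diff almost_symmetry_def f_def of_bool_eq_iff
        not_False_eq_True)
  then obtain S where S: "S \<subseteq> W" "affinely_rigid (add_points f S)"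
    using exists_affinely_rigid_add_points[OF assms(1) _ assms(3)] by blast
  define c' where "c' x \<longleftrightarrow> x \<in> S \<or> c\<^sub>0 x" for x
  have "add_points f S x = of_bool (c' x)" for x
    using S(1) by (auto simp: add_points_def f_def c'_def c\<^sub>0_def)
  then have "affinely_rigid (add_points f S) \<longleftrightarrow> affinely_rigid c'"
    by (simp only: affinely_rigid_def affine_symmetry_def of_bool_eq_iff)
  moreover have "c' x = c x" if "x \<notin> W" for x
    using that S(1) by (auto simp: c'_def c\<^sub>0_def)
  ultimately show ?thesis using that S(2) by blast
qed

lemma rigid_extension:
  fixes c :: "'a::field_char_0 \<Rightarrow> bool"
  assumes "card W \<ge> 9"
  obtains c' where "\<And>x. x \<notin> W \<Longrightarrow> c' x = c x" "affinely_rigid c'"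
proof (cases "\<exists>\<tau>. \<tau> \<noteq> 0 \<and> almost_symmetry (\<lambda>x. x - \<tau>) c")
  case True
  then obtain \<tau> where "\<tau> \<noteq> 0" "almost_symmetry (\<lambda>x. x - \<tau>) c" by blast
  then show ?thesis using assms that by (rule rigid_extension_if_almost_period)
next
  case aperiodic: False
  show ?thesis
  proof (cases "affinely_rigid c")
    case True
    then show ?thesis using that by blast
  next
    case False
    then obtain a b where sym: "affine_symmetry a b c" and "\<not> (a = 1 \<and> b = 0)"
      by (auto simp: affinely_rigid_def)
    obtain V where "V \<subseteq> W" "card V = 2"
      using assms obtain_subset_with_card_n[of 2 W] by auto
    then obtain x y where "x \<in> W" "y \<in> W" "x \<noteq> y" by (auto simp: card_2_iff)
    then obtain w where "w \<in> W" and moved: "a * w + b \<noteq> w"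
      using affine_two_fixed_points[of a x b y] \<open>\<not> (a = 1 \<and> b = 0)\<close> by blast
    have "\<tau> = 0" if "almost_symmetry (\<lambda>x. x - \<tau>) c" for \<tau>
      using aperiodic that by blast
    then have "affinely_rigid (c(w := \<not> c w))"
      using sym moved by (rule affinely_rigid_recoloring)
    then show ?thesis using \<open>w \<in> W\<close> by (intro that[of "c(w := \<not> c w)"]) auto
  qed
qed

section \<open>The distinguishing extension number\<close>

lemma prop_P_mono:
  assumes "V \<subseteq> W" "prop_P X G V"
  shows "prop_P X G W"
  unfolding prop_P_def
proof
  fix c
  obtain c' where "\<forall>x\<in>X - V. c' x = c x" "distinguishing X G c'"
    using assms(2) unfolding prop_P_def by blast
  then show "\<exists>c'. (\<forall>x\<in>X - W. c' x = c x) \<and> distinguishing X G c'"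
    using assms(1) by (intro exI[of _ c']) auto
qed

lemma distinguishing_transfer:
  assumes bij: "bij_betw \<phi> X Y"
    and intertwine: "\<And>g. g \<in> G \<Longrightarrow> \<exists>h\<in>H. \<forall>x\<in>X. g x \<in> X \<and> \<phi> (g x) = h (\<phi> x)"
    and "distinguishing Y H c"
  shows "distinguishing X G (c \<circ> \<phi>)"
  unfolding distinguishing_def
proof (intro ballI impI)
  fix g x assume "g \<in> G" and invariant: "\<forall>x\<in>X. (c \<circ> \<phi>) (g x) = (c \<circ> \<phi>) x" and x: "x \<in> X"
  then obtain h where h: "h \<in> H" "\<And>x. x \<in> X \<Longrightarrow> g x \<in> X \<and> \<phi> (g x) = h (\<phi> x)"
    using intertwine by blast
  have "c (h y) = c y" if "y \<in> Y" for y
    using that invariant h(2) bij by (auto simp: bij_betw_def)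
  then have "h (\<phi> x) = \<phi> x"
    using assms(3) h(1) x bij by (auto simp: distinguishing_def bij_betw_def)
  then show "g x = x" using h(2)[OF x] x bij by (auto simp: bij_betw_def dest: inj_onD)
qed

lemma prop_P_transfer:
  assumes bij: "bij_betw \<phi> X Y" and "W \<subseteq> X"
    and intertwine: "\<And>g. g \<in> G \<Longrightarrow> \<exists>h\<in>H. \<forall>x\<in>X. g x \<in> X \<and> \<phi> (g x) = h (\<phi> x)"
    and "prop_P Y H (\<phi> ` W)"
  shows "prop_P X G W"
  unfolding prop_P_def
proof
  fix c
  obtain c' where c': "\<forall>y\<in>Y - \<phi> ` W. c' y = (c \<circ> inv_into X \<phi>) y"
    and "distinguishing Y H c'"
    using assms(4) unfolding prop_P_def by blast
  have image: "\<phi> ` (X - W) = Y - \<phi> ` W"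
    using bij \<open>W \<subseteq> X\<close> inj_on_image_set_diff[of \<phi> X X W] by (auto simp: bij_betw_def)
  have "(c' \<circ> \<phi>) x = c x" if "x \<in> X - W" for x
  proof -
    have "\<phi> x \<in> Y - \<phi> ` W" using image that by blast
    then show ?thesis using c' bij_betw_inv_into_left[OF bij] that by simp
  qed
  moreover have "distinguishing X G (c' \<circ> \<phi>)"
    using bij intertwine \<open>distinguishing Y H c'\<close> by (rule distinguishing_transfer)
  ultimately show "\<exists>c'. (\<forall>x\<in>X - W. c' x = c x) \<and> distinguishing X G c'"
    by blast
qed

lemma prop_P_affine_group:
  fixes W :: "'a::field_char_0 set"
  assumes "card_at_least W 9"
  shows "prop_P UNIV affine_group W"
proof -
  obtain V where V: "V \<subseteq> W" "card V = 9"
    using assms unfolding card_at_least_def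
    by (metis infinite_arbitrarily_large obtain_subset_with_card_n)
  have "prop_P UNIV affine_group V"
    unfolding prop_P_def
  proof
    fix c :: "'a \<Rightarrow> bool"
    obtain c' where "\<And>x. x \<notin> V \<Longrightarrow> c' x = c x" "affinely_rigid c'"
      using rigid_extension[of V c] V(2) by auto
    then show "\<exists>c'. (\<forall>x\<in>UNIV - V. c' x = c x) \<and> distinguishing UNIV affine_group c'"
      using distinguishing_if_affinely_rigid by blast
  qed
  then show ?thesis using V(1) prop_P_mono by blast
qed

lemma ext_D_le:
  assumes "ext_D_good X G m"
  shows "ext_D X G \<le> enat m"
  using assms by (auto simp: ext_D_def intro: Least_le)

section \<open>The Euclidean plane\<close>

definition to_complex :: "real^2 \<Rightarrow> complex" where
  "to_complex v = Complex (v $ 1) (v $ 2)"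

lemma bij_to_complex: "bij to_complex"
  by (rule bij_betw_byWitness[where f' = "\<lambda>z. vector [Re z, Im z]"])
    (auto simp: to_complex_def vec_eq_iff forall_2)

lemma SE2_intertwines_affine_group:
  assumes "g \<in> SE2"
  shows "\<exists>h\<in>affine_group. \<forall>v. to_complex (g v) = h (to_complex v)"
proof -
  obtain A :: "real^2^2" and t where g: "g = (\<lambda>v. A *v v + t)" and "rotation_matrix A"
    using assms by (auto simp: SE2_def)
  then have "transpose A ** A = mat 1" and det: "det A = 1"
    by (auto simp: rotation_matrix_def orthogonal_matrix_def)
  then have orthonormal: "A$1$1 * A$1$1 + A$2$1 * A$2$1 = 1" "A$1$2 * A$1$2 + A$2$2 * A$2$2 = 1"
      "A$1$1 * A$1$2 + A$2$1 * A$2$2 = 0"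
    by (simp_all add: vec_eq_iff forall_2 matrix_matrix_mult_def transpose_def mat_def sum_2)
  have "A$1$1 * A$2$2 - A$1$2 * A$2$1 = 1" using det by (simp add: det_2)
  then have "A$2$2 = A$1$1" "A$1$2 = - A$2$1" using orthonormal by algebra+
  then have "to_complex (g v) = Complex (A$1$1) (A$2$1) * to_complex v + to_complex t" for v
    by (simp add: g to_complex_def complex_eq_iff matrix_vector_mult_def sum_2 algebra_simps)
  moreover have "Complex (A$1$1) (A$2$1) \<noteq> 0" using orthonormal(1) by (auto simp: complex_eq_iff)
  ultimately show ?thesis unfolding affine_group_def by (metis (mono_tags, lifting) mem_Collect_eq)
qed

lemma ext_D_good_SE2: "ext_D_good (UNIV :: (real^2) set) SE2 9"
  unfolding ext_D_good_def
proof (intro allI impI)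
  fix W :: "(real^2) set"
  assume "W \<subseteq> UNIV \<and> card_at_least W 9 \<and> trivial_pointwise_stabilizer UNIV SE2 W"
  then have "card_at_least (to_complex ` W) 9"
    using bij_is_inj[OF bij_to_complex]
    by (auto simp: card_at_least_def card_image finite_image_iff inj_on_subset)
  then have "prop_P UNIV affine_group (to_complex ` W)" by (rule prop_P_affine_group)
  then show "prop_P UNIV SE2 W"
    using prop_P_transfer[OF bij_to_complex, of W SE2 affine_group] SE2_intertwines_affine_group
    by simp
qed

theorem theorem3p3:
  shows "ext_D (UNIV :: (real^2) set) SE2 < \<infinity>"
  using ext_D_le[OF ext_D_good_SE2] by (rule order.strict_trans1) simp

end
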